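(* Let $(X,d)$ be a complete metric space and let $\mathscr{G}=\{\mathscr{G}(\tau)\}_{\tau\in\mathbb{R}}$ be a continuous and locally uniformly upper semicontinuous (LUUS) generalized process in $X$ with the uniform selected K-property, and let $\{\mathcal{A}(t)\}_{t\in\mathbb{R}}$ be its quasi-invariant global selected pullback attractor. Then the set-valued mapping $t\mapsto \mathcal{A}(t)$ is continuous, i.e., $$\lim_{s\to t}\mathrm{dist}_H(\mathcal{A}(s),\mathcal{A}(t))=0\quad\text{for all } t\in\mathbb{R}.$$
   Context: Let $(X,d)$ be a complete metric space. For $x\in X$, nonempty $A,B\subset X$ and $\varepsilon>0$: $d(x,A)=\inf_{a\in A}d(x,a)$, $\mathrm{dist}(A,B)=\sup_{a\in A}\inf_{b\in B}d(a,b)$, $\mathrm{dist}_H(A,B)=\max\{\mathrm{dist}(A,B),\mathrm{dist}(B,A)\}$, $\mathcal{O}_\varepsilon(A)=\{z\in X: d(z,A)<\varepsilon\}$. Generalized process: a family $\mathscr{G}=\{\mathscr{G}(\tau)\}_{\tau\in\mathbb{R}}$ of sets $\mathscr{G}(\tau)$ consisting of functions $\varphi:[\tau,\infty)\to X$ (called solutions) such that: (C1) for each $\tau\in\mathbb{R}$ and $z\in X$ there is at least one $\varphi\in\mathscr{G}(\tau)$ with $\varphi(\tau)=z$; (C2) if $\varphi\in\mathscr{G}(\tau)$ and $s\ge 0$, then $\varphi|_{[\tau+s,\infty)}\in\mathscr{G}(\tau+s)$; (C3) if $\{\varphi_j\}_{j\in\mathbb{N}}\subset\mathscr{G}(\tau)$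 and $\varphi_j(\tau)\to z$, then there are a subsequence $\{\varphi_{j_k}\}$ and $\varphi\in\mathscr{G}(\tau)$ with $\varphi(\tau)=z$ and $\varphi_{j_k}(t)\to\varphi(t)$ as $k\to\infty$ for each $t\ge\tau$. $\mathscr{G}$ is continuous if all functions in every $\mathscr{G}(\tau)$ are continuous. $\mathscr{G}$ is locally uniformly upper semicontinuous (LUUS) if: whenever $\varphi_j\in\mathscr{G}(\tau)$ for all $j\in\mathbb{N}$ and $\varphi_j(\tau)\to z$, there are $\varphi\in\mathscr{G}(\tau)$ with $\varphi(\tau)=z$ and a subsequence $\{\varphi_{j_k}\}$ with $\varphi_{j_k}\to\varphi$ uniformly on compact subsets of $[\tau,\infty)$. A complete orbit through $x\in X$ at $\tau\in\mathbb{R}$ is a map $\psi:\mathbb{R}\to X$ with $\psi(\tau)=x$ and $\psi|_{[\tau+s,\infty)}\in\mathscr{G}(\tau+s)$ for all $s\in\mathbb{R}$. A family $\mathcal{A}=\{\mathcal{A}(t)\}_{t\in\mathbb{R}}$ of subsets of $X$ is quasi-invariant if for each $\tau\in\mathbb{R}$ and $z\in\mathcal{A}(\tau)$ there is a complete orbit $\psi$ through $z$ at $\tau$ with $\psi(t)\in\mathcal{A}(t)$ for all $t\in\mathbb{R}$. $\mathcal{A}$ select pullback attracts $x\in X$ at time $t\in\mathbb{R}$ if for every $\varepsilon>0$ there is $\tau_0\le t$ such that for all $\tau\le\tau_0$ there is $\varphi_\tau\in\mathscr{G}(\tau)$ with $\varphi_\tau(\tau)=x$ and $\varphi_\tau(t)\in\mathcal{O}_\varepsilon(\mathcal{A}(t))$.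 A global selected pullback attractor of $\mathscr{G}$ is a family $\mathcal{A}=\{\mathcal{A}(t)\}_{t\in\mathbb{R}}$ of nonempty compact subsets of $X$ which select pullback attracts every $x\in X$ at every time $t\in\mathbb{R}$. $\mathscr{G}$ has the uniform selected K-property if there is a family $\{K(t)\}_{t\in\mathbb{R}}$ of nonempty compact subsets of $X$ such that for each $x\in X$ there are solutions $\varphi_\tau\in\mathscr{G}(\tau)$, $\tau\in\mathbb{R}$, with $\varphi_\tau(\tau)=x$ and the following property: for each $t\in\mathbb{R}$ there are $\tau_0\le t$ and positive numbers $\{\varepsilon_\tau(t)\}_{\tau\le\tau_0}$ with $\varepsilon_\tau(t)\to0$ as $\tau\to-\infty$ and $\varphi_\tau(t)\in\mathcal{O}_{\varepsilon_\tau(t)}(K(t))$ for all $\tau\le\tau_0$. (It is known that a generalized process with this property possesses a quasi-invariant global selected pullback attractor.) *)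

theory Defs
  imports "HOL-Analysis.Analysis"
begin

text \<open>
  The complete metric space \<open>X\<close> is a type of class \<open>complete_space\<close>. The distance
  \<open>d(x, A)\<close> is \<open>infdist x A\<close>; as usual for these notions, sets are meant to be nonempty
  (\<open>infdist x {} = 0\<close>). The supremum below is a real supremum, hence meaningful only if it is
  finite, e.g. for nonempty bounded \<open>A\<close> and \<open>B\<close>. All sets to which it is applied are nonempty
  and compact.
\<close>

definition semidist :: "'a::metric_space set \<Rightarrow> 'a set \<Rightarrow> real" where
  "semidist A B = (SUP a\<in>A. infdist a B)"

definition hausdorff_dist :: "'a::metric_space set \<Rightarrow> 'a set \<Rightarrow> real" where
  "hausdorff_dist A B = max (semidist A B) (semidist B A)"

definition nbhd :: "real \<Rightarrow> 'a::metric_space set \<Rightarrow> 'a set" where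
  "nbhd \<epsilon> A = {z. infdist z A < \<epsilon>}"

text \<open>
  A function \<open>[\<tau>, \<infinity>) \<rightarrow> X\<close> is represented by the function on all reals that agrees with it on
  \<open>{\<tau>..}\<close> and takes the value \<open>undefined\<close> elsewhere (\<open>extensional {\<tau>..}\<close>), so that equality
  of solutions is equality on \<open>{\<tau>..}\<close>, and restriction to a smaller half-line is
  \<open>restrict\<close>.
\<close>

definition generalized_process :: "(real \<Rightarrow> (real \<Rightarrow> 'a::metric_space) set) \<Rightarrow> bool" where
  "generalized_process G \<longleftrightarrow>
     (\<forall>\<tau>. G \<tau> \<subseteq> extensional {\<tau>..}) \<and>
     (\<forall>\<tau> z. \<exists>\<phi>\<in>G \<tau>. \<phi> \<tau> = z) \<and>
     (\<forall>\<tau>. \<forall>\<phi>\<in>G \<tau>. \<forall>s\<ge>0. restrict \<phi> {\<tau> + s..} \<in> G (\<tau> + s)) \<and>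
     (\<forall>\<tau> (\<phi> :: nat \<Rightarrow> real \<Rightarrow> 'a) z.
        (\<forall>j. \<phi> j \<in> G \<tau>) \<and> (\<lambda>j. \<phi> j \<tau>) \<longlonglongrightarrow> z \<longrightarrow>
        (\<exists>(r :: nat \<Rightarrow> nat) \<psi>. strict_mono r \<and> \<psi> \<in> G \<tau> \<and> \<psi> \<tau> = z \<and>
           (\<forall>t\<ge>\<tau>. (\<lambda>k. \<phi> (r k) t) \<longlonglongrightarrow> \<psi> t)))"

definition continuous_process :: "(real \<Rightarrow> (real \<Rightarrow> 'a::metric_space) set) \<Rightarrow> bool" where
  "continuous_process G \<longleftrightarrow> (\<forall>\<tau>. \<forall>\<phi>\<in>G \<tau>. continuous_on {\<tau>..} \<phi>)"

definition LUUS :: "(real \<Rightarrow> (real \<Rightarrow> 'a::metric_space) set) \<Rightarrow> bool" where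
  "LUUS G \<longleftrightarrow>
     (\<forall>\<tau> (\<phi> :: nat \<Rightarrow> real \<Rightarrow> 'a) z.
        (\<forall>j. \<phi> j \<in> G \<tau>) \<and> (\<lambda>j. \<phi> j \<tau>) \<longlonglongrightarrow> z \<longrightarrow>
        (\<exists>(r :: nat \<Rightarrow> nat) \<psi>. strict_mono r \<and> \<psi> \<in> G \<tau> \<and> \<psi> \<tau> = z \<and>
           (\<forall>C. compact C \<and> C \<subseteq> {\<tau>..} \<longrightarrow>
              uniform_limit C (\<lambda>k. \<phi> (r k)) \<psi> sequentially)))"

definition complete_orbit ::
    "(real \<Rightarrow> (real \<Rightarrow> 'a) set) \<Rightarrow> 'a \<Rightarrow> real \<Rightarrow> (real \<Rightarrow> 'a) \<Rightarrow> bool" where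
  "complete_orbit G x \<tau> \<psi> \<longleftrightarrow>
     \<psi> \<tau> = x \<and> (\<forall>s. restrict \<psi> {\<tau> + s..} \<in> G (\<tau> + s))"

definition quasi_invariant :: "(real \<Rightarrow> (real \<Rightarrow> 'a) set) \<Rightarrow> (real \<Rightarrow> 'a set) \<Rightarrow> bool" where
  "quasi_invariant G A \<longleftrightarrow>
     (\<forall>\<tau>. \<forall>z\<in>A \<tau>. \<exists>\<psi>. complete_orbit G z \<tau> \<psi> \<and> (\<forall>t. \<psi> t \<in> A t))"

definition select_pullback_attracts ::
    "(real \<Rightarrow> (real \<Rightarrow> 'a::metric_space) set) \<Rightarrow> (real \<Rightarrow> 'a set) \<Rightarrow> 'a \<Rightarrow> real \<Rightarrow> bool" where
  "select_pullback_attracts G A x t \<longleftrightarrow>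
     (\<forall>\<epsilon>>0. \<exists>\<tau>0\<le>t. \<forall>\<tau>\<le>\<tau>0. \<exists>\<phi>\<in>G \<tau>. \<phi> \<tau> = x \<and> \<phi> t \<in> nbhd \<epsilon> (A t))"

definition global_selected_pullback_attractor ::
    "(real \<Rightarrow> (real \<Rightarrow> 'a::metric_space) set) \<Rightarrow> (real \<Rightarrow> 'a set) \<Rightarrow> bool" where
  "global_selected_pullback_attractor G A \<longleftrightarrow>
     (\<forall>t. A t \<noteq> {} \<and> compact (A t)) \<and> (\<forall>x t. select_pullback_attracts G A x t)"

text \<open>
  In the following definition the solutions \<open>\<phi> \<tau>\<close> depend on \<open>x\<close> but not on \<open>t\<close>, and only the
  values \<open>\<epsilon> \<tau>\<close> with \<open>\<tau> \<le> \<tau>0\<close> matter.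
\<close>

definition uniform_selected_K_property ::
    "(real \<Rightarrow> (real \<Rightarrow> 'a::metric_space) set) \<Rightarrow> bool" where
  "uniform_selected_K_property G \<longleftrightarrow>
     (\<exists>K :: real \<Rightarrow> 'a set.
        (\<forall>t. K t \<noteq> {} \<and> compact (K t)) \<and>
        (\<forall>x. \<exists>\<phi> :: real \<Rightarrow> real \<Rightarrow> 'a.
           (\<forall>\<tau>. \<phi> \<tau> \<in> G \<tau> \<and> \<phi> \<tau> \<tau> = x) \<and>
           (\<forall>t. \<exists>\<tau>0\<le>t. \<exists>\<epsilon> :: real \<Rightarrow> real.
              (\<forall>\<tau>\<le>\<tau>0. \<epsilon> \<tau> > 0) \<and> (\<epsilon> \<longlongrightarrow> 0) at_bot \<and>
              (\<forall>\<tau>\<le>\<tau>0. \<phi> \<tau> t \<in> nbhd (\<epsilon> \<tau>) (K t)))))"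

end

theory Submission
  imports Defs
begin

text \<open>
  The complete orbits that run inside \<open>A\<close> are equicontinuous at every time \<open>t\<close>: otherwise, starting
  them in the compact set \<open>A (t - 1)\<close>, the LUUS property yields a subsequence converging uniformly
  near \<open>t\<close> to a continuous solution, which is impossible. By quasi-invariance every point of \<open>A s\<close>
  (of \<open>A t\<close>) lies on such an orbit, whose value at \<open>t\<close> (at \<open>s\<close>) is a nearby point of the other
  set, so one modulus bounds both semidistances.
\<close>

text \<open>The offset in \<open>complete_orbit\<close> ranges over all reals, negative ones
  included, so \<open>\<sigma> - \<tau>\<close> reaches every half-line.\<close>

lemma complete_orbit_restrict:
  assumes "complete_orbit G x \<tau> \<psi>"
  shows "restrict \<psi> {\<sigma>..} \<in> G \<sigma>"
  using assms[unfolded complete_orbit_def, THEN conjunct2, THEN spec, of "\<sigma> - \<tau>"] by simp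

lemma semidist_le:
  assumes "A \<noteq> {}" and "\<And>a. a \<in> A \<Longrightarrow> infdist a B \<le> e"
  shows "semidist A B \<le> e"
  unfolding semidist_def using assms by (intro cSUP_least)

text \<open>The bound \<open>e\<close> makes the distances bounded above, so that the real supremum
  dominates each of them.\<close>

lemma semidist_nonneg:
  assumes "A \<noteq> {}" and "\<And>a. a \<in> A \<Longrightarrow> infdist a B \<le> e"
  shows "0 \<le> semidist A B"
proof -
  obtain a where a: "a \<in> A"
    using assms(1) by blast
  have "0 \<le> infdist a B"
    by (rule infdist_nonneg)
  also have "\<dots> \<le> semidist A B"
    unfolding semidist_def using assms(2) a by (intro cSUP_upper bdd_aboveI2)
  finally show ?thesis .
qed

text \<open>Compare through \<open>g (x n)\<close>: uniform convergence controls \<open>f n\<close>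
  wherever \<open>x n\<close> lies in \<open>C\<close>, and continuity of \<open>g\<close> does the
  rest.\<close>

lemma uniform_limit_tendsto_diagonal:
  assumes lim: "uniform_limit C f g sequentially"
    and cont: "continuous_on C g"
    and x: "\<And>n. x n \<in> C" "x \<longlonglongrightarrow> a" "a \<in> C"
  shows "(\<lambda>n. f n (x n)) \<longlonglongrightarrow> g a"
proof (rule tendstoI)
  fix e :: real assume "e > 0"
  then have e: "e / 2 > 0" by simp
  have "(\<lambda>n. g (x n)) \<longlonglongrightarrow> g a"
    using continuous_on_tendsto_compose[OF cont x(2,3)] x(1) by simp
  then have "\<forall>\<^sub>F n in sequentially. dist (g (x n)) (g a) < e / 2"
    using e by (rule tendstoD)
  with uniform_limitD[OF lim e]
  show "\<forall>\<^sub>F n in sequentially. dist (f n (x n)) (g a) < e"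
  proof eventually_elim
    case (elim n)
    then have "dist (f n (x n)) (g (x n)) < e / 2"
      using x(1) by blast
    with elim(2) show ?case
      using dist_triangle[of "f n (x n)" "g a" "g (x n)"] by linarith
  qed
qed

lemma orbits_in_equicontinuous:
  fixes G :: "real \<Rightarrow> (real \<Rightarrow> 'a::metric_space) set"
  assumes cont: "continuous_process G"
    and luus: "LUUS G"
    and compact: "\<And>t. compact (A t)"
    and "e > 0"
  obtains d where "d > 0"
    "\<And>s \<psi>. \<bar>s - t\<bar> < d \<Longrightarrow> (\<And>\<tau>. restrict \<psi> {\<tau>..} \<in> G \<tau>) \<Longrightarrow> (\<And>\<tau>. \<psi> \<tau> \<in> A \<tau>) \<Longrightarrow>
       dist (\<psi> s) (\<psi> t) < e"
proof (rule ccontr)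
  assume "\<not> thesis"
  \<comment> \<open>Each \<open>inverse (real (Suc n))\<close> fails as a modulus; the failures
    supply times tending to \<open>t\<close> and orbits with a gap of at least
    \<open>e\<close>.\<close>
  have "\<exists>s \<psi>. \<bar>s - t\<bar> < inverse (real (Suc n)) \<and> (\<forall>\<tau>. restrict \<psi> {\<tau>..} \<in> G \<tau>) \<and>
      (\<forall>\<tau>. \<psi> \<tau> \<in> A \<tau>) \<and> \<not> dist (\<psi> s) (\<psi> t) < e" for n
  proof (rule ccontr)
    assume "\<not> ?thesis"
    then have thesis
      using that[of "inverse (real (Suc n))", OF inverse_Suc] by blast
    with \<open>\<not> thesis\<close> show False ..
  qed
  then obtain s \<psi> where "\<And>n. \<bar>s n - t\<bar> < inverse (real (Suc n)) \<and>
      (\<forall>\<tau>. restrict (\<psi> n) {\<tau>..} \<in> G \<tau>) \<and>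
      (\<forall>\<tau>. \<psi> n \<tau> \<in> A \<tau>) \<and> \<not> dist (\<psi> n (s n)) (\<psi> n t) < e"
    by metis
  then have s: "\<And>n. \<bar>s n - t\<bar> < inverse (real (Suc n))"
    and G: "\<And>n \<tau>. restrict (\<psi> n) {\<tau>..} \<in> G \<tau>"
    and A: "\<And>n \<tau>. \<psi> n \<tau> \<in> A \<tau>"
    and far: "\<And>n. \<not> dist (\<psi> n (s n)) (\<psi> n t) < e"
    by blast+
  \<comment> \<open>Since \<open>s n\<close> is less than 1 away from \<open>t\<close>, starting one
    unit earlier covers the times on both sides of \<open>t\<close>.\<close>
  define \<tau> where "\<tau> = t - 1"
  obtain l r where r: "strict_mono r" "(\<lambda>n. \<psi> (r n) \<tau>) \<longlonglongrightarrow> l"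
    using compact[of \<tau>, unfolded compact_def, rule_format, of "\<lambda>n. \<psi> n \<tau>"] A
    by (auto simp: o_def)
  \<comment> \<open>Members of \<open>G \<tau>\<close> live on a half-line, so the orbits are cut at
    \<open>\<tau>\<close>; their values at \<open>t\<close> and at every \<open>s n\<close>
    survive.\<close>
  define \<phi> where "\<phi> n = restrict (\<psi> (r n)) {\<tau>..}" for n
  have "(\<forall>j. \<phi> j \<in> G \<tau>) \<and> (\<lambda>j. \<phi> j \<tau>) \<longlonglongrightarrow> l"
    using G r(2) by (simp add: \<phi>_def)
  then obtain q \<xi> where q: "strict_mono q" and \<xi>: "\<xi> \<in> G \<tau>"
    and "\<And>C. compact C \<Longrightarrow> C \<subseteq> {\<tau>..} \<Longrightarrow> uniform_limit C (\<lambda>k. \<phi> (q k)) \<xi> sequentially"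
    using luus unfolding LUUS_def by metis
  then have lim: "uniform_limit {\<tau>..t + 1} (\<lambda>k. \<phi> (q k)) \<xi> sequentially"
    by simp
  have cont\<xi>: "continuous_on {\<tau>..t + 1} \<xi>"
    by (rule continuous_on_subset[of "{\<tau>..}"])
      (use cont \<xi> in \<open>auto simp: continuous_process_def\<close>)
  have s_mem: "s n \<in> {\<tau>..t + 1}" for n
  proof -
    have "inverse (real (Suc n)) \<le> 1"
      by (simp add: inverse_eq_divide)
    with s[of n] have "\<bar>s n - t\<bar> < 1"
      by linarith
    then show ?thesis
      by (auto simp: \<tau>_def)
  qed
  have "(\<lambda>n. s n - t) \<longlonglongrightarrow> 0"
    by (rule Lim_null_comparison[OF _ LIMSEQ_inverse_real_of_nat])
      (use s in \<open>auto intro!: always_eventually less_imp_le simp del: of_nat_Suc\<close>)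
  then have "s \<longlonglongrightarrow> t"
    by (simp add: LIM_zero_iff)
  then have "(\<lambda>n. s (r (q n))) \<longlonglongrightarrow> t"
    using LIMSEQ_subseq_LIMSEQ[OF _ strict_mono_o[OF r(1) q]] by (simp add: o_def)
  \<comment> \<open>The values at the moving times and at the fixed time \<open>t\<close> have the
    same limit \<open>\<xi> t\<close>, so the gap closes, contrary to \<open>far\<close>.\<close>
  then have "(\<lambda>n. \<phi> (q n) (s (r (q n)))) \<longlonglongrightarrow> \<xi> t"
    using s_mem by (intro uniform_limit_tendsto_diagonal[OF lim cont\<xi>]) (auto simp: \<tau>_def)
  moreover have "(\<lambda>n. \<phi> (q n) t) \<longlonglongrightarrow> \<xi> t"
    by (intro tendsto_uniform_limitI[OF lim]) (simp add: \<tau>_def)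
  ultimately have "(\<lambda>n. dist (\<phi> (q n) (s (r (q n)))) (\<phi> (q n) t)) \<longlonglongrightarrow> dist (\<xi> t) (\<xi> t)"
    by (rule tendsto_dist)
  then have "\<forall>\<^sub>F n in sequentially. dist (\<phi> (q n) (s (r (q n)))) (\<phi> (q n) t) < e"
    using \<open>e > 0\<close> by (intro order_tendstoD) auto
  then obtain n where "dist (\<phi> (q n) (s (r (q n)))) (\<phi> (q n) t) < e"
    by (auto simp: eventually_sequentially)
  then show False
    using far[of "r (q n)"] s_mem[of "r (q n)"] by (simp add: \<phi>_def \<tau>_def)
qed

theorem theorem10:
  fixes G :: "real \<Rightarrow> (real \<Rightarrow> 'a::complete_space) set"
    and A :: "real \<Rightarrow> 'a set"
  assumes "generalized_process G"
    and "continuous_process G"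
    and "LUUS G"
    and "uniform_selected_K_property G"
    and "global_selected_pullback_attractor G A"
    and "quasi_invariant G A"
  shows "\<forall>t. ((\<lambda>s. hausdorff_dist (A s) (A t)) \<longlongrightarrow> 0) (at t)"
proof (intro allI tendstoI)
  fix t e :: real assume "e > 0"
  have A: "compact (A s)" "A s \<noteq> {}" for s
    using assms(5) unfolding global_selected_pullback_attractor_def by auto
  \<comment> \<open>Suprema keep only weak bounds; \<open>e / 2\<close> leaves room for the strict
    bound by \<open>e\<close>.\<close>
  obtain d where "d > 0"
    and d: "\<And>s \<psi>. \<bar>s - t\<bar> < d \<Longrightarrow> (\<And>\<tau>. restrict \<psi> {\<tau>..} \<in> G \<tau>) \<Longrightarrow> (\<And>\<tau>. \<psi> \<tau> \<in> A \<tau>) \<Longrightarrow>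
       dist (\<psi> s) (\<psi> t) < e / 2"
    using orbits_in_equicontinuous[where A = A and e = "e / 2", OF assms(2,3) A(1)] \<open>e > 0\<close>
    by (metis half_gt_zero)
  have "dist (hausdorff_dist (A s) (A t)) 0 < e" if s: "dist s t < d" for s
  proof -
    \<comment> \<open>The base time \<open>\<tau>\<close> is left free: it is \<open>s\<close> for
      one semidistance and \<open>t\<close> for the other.\<close>
    have orbit: "\<exists>\<psi>. \<psi> \<tau> = z \<and> (\<forall>\<sigma>. \<psi> \<sigma> \<in> A \<sigma>) \<and> dist (\<psi> s) (\<psi> t) < e / 2" if "z \<in> A \<tau>" for z \<tau>
    proof -
      from assms(6) that obtain \<psi> where \<psi>: "complete_orbit G z \<tau> \<psi>" "\<And>\<sigma>. \<psi> \<sigma> \<in> A \<sigma>"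
        unfolding quasi_invariant_def by blast
      have "dist (\<psi> s) (\<psi> t) < e / 2"
        using s complete_orbit_restrict[OF \<psi>(1)] \<psi>(2) by (intro d) (auto simp: dist_real_def)
      with \<psi> show ?thesis
        unfolding complete_orbit_def by blast
    qed
    have st: "infdist z (A t) \<le> e / 2" if "z \<in> A s" for z
      using orbit[OF that] by (metis infdist_le2 less_imp_le)
    have ts: "infdist z (A s) \<le> e / 2" if "z \<in> A t" for z
      using orbit[OF that] by (metis infdist_le2 less_imp_le dist_commute)
    \<comment> \<open>One nonnegative semidistance makes the maximum nonnegative, so its distance to
      0 is the maximum itself.\<close>
    have "semidist (A s) (A t) \<le> e / 2" "semidist (A t) (A s) \<le> e / 2" "0 \<le> semidist (A s) (A t)"
      using semidist_le[OF A(2)] semidist_nonneg[OF A(2)] st ts by blast+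
    then show ?thesis
      using \<open>e > 0\<close> by (simp add: hausdorff_dist_def)
  qed
  then show "\<forall>\<^sub>F s in at t. dist (hausdorff_dist (A s) (A t)) 0 < e"
    using \<open>d > 0\<close> by (auto simp: eventually_at)
qed

end
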